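(* Let $R:\widehat{\mathbb{C}}\to\widehat{\mathbb{C}}$ be a rational function that is not a Lattès map, and let $\sigma\in\mathcal{I}(\widehat{\mathbb{C}})$ be a holomorphic isometry of the Riemann sphere. If $R\circ\sigma=\sigma^k\circ R$ for some integer $k\geq 1$, then $\sigma\in\Sigma(R)$, i.e. $\sigma(J(R))=J(R)$.
   Context: $\widehat{\mathbb{C}}=\mathbb{C}\cup\{\infty\}$ is the Riemann sphere and $J(R)$ is the Julia set of $R$. The group of holomorphic isometries of $\widehat{\mathbb{C}}$ is $$\mathcal{I}(\widehat{\mathbb{C}})=\left\{z\mapsto\frac{az-\bar b}{bz+\bar a} : a,b\in\mathbb{C},\ |a|^2+|b|^2=1\right\},$$ and $\Sigma(R)=\{\sigma\in\mathcal{I}(\widehat{\mathbb{C}}) : \sigma(J(R))=J(R)\}$. Here $\sigma^k$ denotes the $k$-fold composition of $\sigma$ with itself. *)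

theory Defs
  imports "HOL-Complex_Analysis.Complex_Analysis" "HOL-Computational_Algebra.Polynomial"
begin

datatype riemann_sphere = Fin complex | Infty

text \<open>Inverse stereographic projection onto the unit sphere of \<open>\<complex> \<times> \<real>\<close>; the north pole
  represents infinity. The Riemann sphere carries the induced (chordal) metric.\<close>

primrec stereo :: "riemann_sphere \<Rightarrow> complex \<times> real" where
  "stereo (Fin z) =
     (2 * z / of_real (1 + (cmod z)\<^sup>2), ((cmod z)\<^sup>2 - 1) / ((cmod z)\<^sup>2 + 1))"
| "stereo Infty = (0, 1)"

lemma stereo_Fin_ne_north: "((cmod z)\<^sup>2 - 1) / ((cmod z)\<^sup>2 + 1) \<noteq> 1"
proof -
  have "(cmod z)\<^sup>2 + 1 > 0" by (simp add: add_nonneg_pos)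
  then show ?thesis by (simp add: divide_eq_eq)
qed

lemma inj_stereo: "inj stereo"
proof (rule injI)
  fix x y assume eq: "stereo x = stereo y"
  show "x = y"
  proof (cases x; cases y)
    fix z w assume xy: "x = Fin z" "y = Fin w"
    have pos: "(cmod z)\<^sup>2 + 1 > 0" "(cmod w)\<^sup>2 + 1 > 0" by (simp_all add: add_nonneg_pos)
    have "((cmod z)\<^sup>2 - 1) / ((cmod z)\<^sup>2 + 1) = ((cmod w)\<^sup>2 - 1) / ((cmod w)\<^sup>2 + 1)"
      using eq xy by simp
    then have "((cmod z)\<^sup>2 - 1) * ((cmod w)\<^sup>2 + 1) = ((cmod w)\<^sup>2 - 1) * ((cmod z)\<^sup>2 + 1)"
      using pos by (simp add: frac_eq_eq)
    then have n: "(cmod z)\<^sup>2 = (cmod w)\<^sup>2" by (simp add: algebra_simps)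
    have "complex_of_real (1 + (cmod w)\<^sup>2) \<noteq> 0"
      using pos by (simp only: of_real_eq_0_iff)
    moreover have "2 * z / complex_of_real (1 + (cmod w)\<^sup>2) = 2 * w / complex_of_real (1 + (cmod w)\<^sup>2)"
      using eq n by (simp add: xy)
    ultimately show ?thesis using xy by (simp del: of_real_add)
  qed (use eq stereo_Fin_ne_north stereo_Fin_ne_north[symmetric] in auto)
qed

instantiation riemann_sphere :: metric_space
begin

definition dist_riemann_sphere :: "riemann_sphere \<Rightarrow> riemann_sphere \<Rightarrow> real" where
  "dist_riemann_sphere x y = dist (stereo x) (stereo y)"

definition uniformity_riemann_sphere :: "(riemann_sphere \<times> riemann_sphere) filter" where
  "uniformity_riemann_sphere = (INF e\<in>{0<..}. principal {(x, y). dist x y < e})"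

definition open_riemann_sphere :: "riemann_sphere set \<Rightarrow> bool" where
  "open_riemann_sphere U \<longleftrightarrow> (\<forall>x\<in>U. \<forall>\<^sub>F (x', y) in uniformity. x' = x \<longrightarrow> y \<in> U)"

instance
proof
  fix x y z :: riemann_sphere
  show "dist x y = 0 \<longleftrightarrow> x = y"
    by (simp add: dist_riemann_sphere_def inj_eq[OF inj_stereo])
  show "dist x y \<le> dist x z + dist y z"
    by (simp add: dist_riemann_sphere_def dist_triangle2)
qed (simp_all add: uniformity_riemann_sphere_def open_riemann_sphere_def)

end

text \<open>The map induced by \<open>p / q\<close>. At infinity it is the ratio of the coefficients in degree
  \<open>max (degree p) (degree q)\<close>, i.e. the limit of \<open>p / q\<close>, with quotients by 0 read as infinity.
  This is meaningful only when \<open>p\<close> and \<open>q\<close> are coprime; coprimality excludes \<open>p = q = 0\<close>,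
  and \<open>q = 0\<close> then gives the constant map infinity.\<close>

definition rat_eval :: "complex poly \<Rightarrow> complex poly \<Rightarrow> riemann_sphere \<Rightarrow> riemann_sphere" where
  "rat_eval p q x = (case x of
     Fin z \<Rightarrow> if poly q z = 0 then Infty else Fin (poly p z / poly q z)
   | Infty \<Rightarrow> let d = max (degree p) (degree q) in
       if coeff q d = 0 then Infty else Fin (coeff p d / coeff q d))"

definition rational_of_degree :: "nat \<Rightarrow> (riemann_sphere \<Rightarrow> riemann_sphere) \<Rightarrow> bool" where
  "rational_of_degree d R \<longleftrightarrow>
     (\<exists>p q. coprime p q \<and> d = max (degree p) (degree q) \<and> R = rat_eval p q)"

definition rational_map :: "(riemann_sphere \<Rightarrow> riemann_sphere) \<Rightarrow> bool" where
  "rational_map R \<longleftrightarrow> (\<exists>d. rational_of_degree d R)"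

text \<open>Normality in the sense of Montel. For maps into the (compact) Riemann sphere the limit may
  take the value infinity, so no separate clause for divergence is needed.\<close>

definition normal_family_on ::
    "'a::topological_space set \<Rightarrow> ('a \<Rightarrow> 'b::metric_space) set \<Rightarrow> bool" where
  "normal_family_on U F \<longleftrightarrow>
     (\<forall>f :: nat \<Rightarrow> 'a \<Rightarrow> 'b. range f \<subseteq> F \<longrightarrow>
        (\<exists>r g. strict_mono r \<and>
           (\<forall>K. compact K \<and> K \<subseteq> U \<longrightarrow> uniform_limit K (\<lambda>n. f (r n)) g sequentially)))"

definition Fatou_set :: "(riemann_sphere \<Rightarrow> riemann_sphere) \<Rightarrow> riemann_sphere set" where
  "Fatou_set R = {x. \<exists>U. open U \<and> x \<in> U \<and> normal_family_on U (range (\<lambda>n. R ^^ n))}"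

definition Julia_set :: "(riemann_sphere \<Rightarrow> riemann_sphere) \<Rightarrow> riemann_sphere set" where
  "Julia_set R = - Fatou_set R"

definition lattice :: "complex set \<Rightarrow> bool" where
  "lattice \<Lambda> \<longleftrightarrow> (\<exists>\<omega>\<^sub>1 \<omega>\<^sub>2. Im (\<omega>\<^sub>2 / \<omega>\<^sub>1) \<noteq> 0 \<and>
     \<Lambda> = {of_int m * \<omega>\<^sub>1 + of_int n * \<omega>\<^sub>2 | m n. True})"

definition sphere_map :: "(complex \<Rightarrow> complex) \<Rightarrow> complex \<Rightarrow> riemann_sphere" where
  "sphere_map f z = (if is_pole f z then Infty else Fin (f z))"

text \<open>A Lattes map is a rational map of degree at least 2 that is semiconjugate to an affine
  self-map \<open>z \<mapsto> a z + b\<close> of a torus \<open>\<complex> / \<Lambda>\<close> (well defined on the torus because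
  \<open>a \<Lambda> \<subseteq> \<Lambda>\<close>) through a nonconstant holomorphic map from \<open>\<complex> / \<Lambda>\<close> to the sphere. The latter is
  given by a nonconstant \<open>\<Lambda>\<close>-periodic meromorphic function \<open>f\<close>; \<open>nicely_meromorphic_on\<close>
  normalises its values at removable singularities.\<close>

definition Lattes_map :: "(riemann_sphere \<Rightarrow> riemann_sphere) \<Rightarrow> bool" where
  "Lattes_map R \<longleftrightarrow>
     (\<exists>d\<ge>2. rational_of_degree d R) \<and>
     (\<exists>\<Lambda> f a b. lattice \<Lambda> \<and>
        f nicely_meromorphic_on UNIV \<and> \<not> f constant_on UNIV \<and>
        (\<forall>z. \<forall>l\<in>\<Lambda>. f (z + l) = f z) \<and>
        (\<forall>l\<in>\<Lambda>. a * l \<in> \<Lambda>) \<and>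
        (\<forall>z. R (sphere_map f z) = sphere_map f (a * z + b)))"

definition sphere_isometries :: "(riemann_sphere \<Rightarrow> riemann_sphere) set" where
  "sphere_isometries =
     {rat_eval [:- cnj b, a:] [:cnj a, b:] | a b. (cmod a)\<^sup>2 + (cmod b)\<^sup>2 = 1}"

definition Julia_symmetries ::
    "(riemann_sphere \<Rightarrow> riemann_sphere) \<Rightarrow> (riemann_sphere \<Rightarrow> riemann_sphere) set" where
  "Julia_symmetries R = {\<sigma> \<in> sphere_isometries. \<sigma> ` Julia_set R = Julia_set R}"

end

theory Submission
  imports Defs
begin

text \<open>
  The reason is that the group of isometries of the sphere is equicontinuous. Iterating
  \<open>R \<circ> \<sigma> = \<sigma>\<^sup>k \<circ> R\<close> gives \<open>R\<^sup>n \<circ> \<sigma> = \<tau>\<^sub>n \<circ> R\<^sup>n\<close> where \<open>\<tau>\<^sub>n\<close> is a power of \<open>\<sigma>\<close> (the exponent is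
  \<open>k\<^sup>n\<close>). If a sequence of iterates converges locally uniformly on \<open>U\<close> to \<open>g\<close>, then by
  Arzela--Ascoli the corresponding \<open>\<tau>\<^sub>n\<close> converge uniformly on the whole sphere along a further
  subsequence, say to \<open>\<tau>\<close>, and the same iterates converge on \<open>\<sigma>(U)\<close> to
  \<open>\<tau> \<circ> g \<circ> \<sigma>\<^sup>-\<^sup>1\<close>. Hence \<open>\<sigma>\<close> maps the Fatou set into itself
  (\<open>Fatou_set_semiconj_isometry\<close>). The inverse of \<open>\<sigma>\<close> satisfies the same functional equation,
  so \<open>\<sigma>\<close> maps the Fatou set, and therefore its complement, onto itself.

  The argument needs two facts about the sphere: it is compact, and the Moebius maps in question
  are bijective isometries of the chordal metric. The latter is clearest in homogeneous
  coordinates, where \<open>\<sigma>\<close> is the action of a special unitary matrix: both the Hermitian norm and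
  the determinant of two vectors are invariant, and the chordal distance is expressed by them
  (\<open>inner_stereo_homog\<close>).
\<close>

section \<open>The chordal metric in homogeneous coordinates\<close>

definition homog :: "complex \<Rightarrow> complex \<Rightarrow> riemann_sphere" where
  "homog u v = (if v = 0 then Infty else Fin (u / v))"

lemma homog_cases:
  obtains u v where "x = homog u v" "u \<noteq> 0 \<or> v \<noteq> 0"
proof (cases x)
  case (Fin z)
  then show ?thesis using that[of z 1] by (simp add: homog_def)
next
  case Infty
  then show ?thesis using that[of 1 0] by (simp add: homog_def)
qed

lemma cmod_square_sum_pos: "u \<noteq> 0 \<or> v \<noteq> 0 \<Longrightarrow> (cmod u)\<^sup>2 + (cmod v)\<^sup>2 > 0"
  by (auto simp: add_pos_nonneg add_nonneg_pos)

lemma stereo_homog: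
  assumes "u \<noteq> 0 \<or> v \<noteq> 0"
  defines "N \<equiv> (cmod u)\<^sup>2 + (cmod v)\<^sup>2"
  shows "stereo (homog u v) = (2 * u * cnj v / of_real N, ((cmod u)\<^sup>2 - (cmod v)\<^sup>2) / N)"
proof (cases "v = 0")
  case True
  then show ?thesis using assms by (simp add: homog_def)
next
  case False
  have N: "N > 0" using assms cmod_square_sum_pos by blast
  have v: "(cmod v)\<^sup>2 \<noteq> 0" using False by simp
  have eq: "1 + (cmod (u / v))\<^sup>2 = N / (cmod v)\<^sup>2"
    using v by (simp add: N_def norm_divide power_divide field_simps)
  have "2 * (u / v) / of_real (1 + (cmod (u / v))\<^sup>2) = 2 * u * cnj v / of_real N"
    unfolding eq of_real_divide complex_norm_square using False N by (simp add: field_simps)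
  moreover have "((cmod (u / v))\<^sup>2 - 1) / ((cmod (u / v))\<^sup>2 + 1) = ((cmod u)\<^sup>2 - (cmod v)\<^sup>2) / N"
    unfolding add.commute[of _ 1] eq using v N by (simp add: norm_divide power_divide field_simps)
  ultimately show ?thesis using False by (simp add: homog_def)
qed

text \<open>With \<open>u v' - u' v\<close> the determinant of the two vectors, this is the Lagrange identity
  \<open>|\<langle>w, w'\<rangle>|\<^sup>2 + |det (w, w')|\<^sup>2 = |w|\<^sup>2 |w'|\<^sup>2\<close>: for unit vectors \<open>w, w'\<close> the inner product of
  the corresponding points of the unit sphere is \<open>2 |\<langle>w, w'\<rangle>|\<^sup>2 - 1\<close>.\<close>

lemma inner_stereo_homog:
  assumes "u \<noteq> 0 \<or> v \<noteq> 0" "u' \<noteq> 0 \<or> v' \<noteq> 0"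
  shows "inner (stereo (homog u v)) (stereo (homog u' v')) =
    1 - 2 * (cmod (u * v' - u' * v))\<^sup>2 /
      (((cmod u)\<^sup>2 + (cmod v)\<^sup>2) * ((cmod u')\<^sup>2 + (cmod v')\<^sup>2))"
proof -
  define N N' where "N = (cmod u)\<^sup>2 + (cmod v)\<^sup>2" and "N' = (cmod u')\<^sup>2 + (cmod v')\<^sup>2"
  have pos: "N > 0" "N' > 0" using assms cmod_square_sum_pos by (auto simp: N_def N'_def)
  have "inner (stereo (homog u v)) (stereo (homog u' v')) =
      (inner (2 * u * cnj v) (2 * u' * cnj v')
        + ((cmod u)\<^sup>2 - (cmod v)\<^sup>2) * ((cmod u')\<^sup>2 - (cmod v')\<^sup>2)) / (N * N')"
    using assms pos
    by (simp add: stereo_homog inner_complex_def N_def[symmetric] N'_def[symmetric]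
        Re_divide_of_real Im_divide_of_real) (simp add: field_simps)
  also have "inner (2 * u * cnj v) (2 * u' * cnj v')
        + ((cmod u)\<^sup>2 - (cmod v)\<^sup>2) * ((cmod u')\<^sup>2 - (cmod v')\<^sup>2)
      = N * N' - 2 * (cmod (u * v' - u' * v))\<^sup>2"
    unfolding N_def N'_def inner_complex_def cmod_power2
    by (simp add: power2_eq_square algebra_simps)
  finally show ?thesis
    using pos by (simp add: N_def[symmetric] N'_def[symmetric] diff_divide_distrib)
qed

lemma norm_stereo [simp]: "norm (stereo x) = 1"
proof -
  obtain u v where "x = homog u v" "u \<noteq> 0 \<or> v \<noteq> 0" by (rule homog_cases)
  then show ?thesis by (simp add: norm_eq_sqrt_inner inner_stereo_homog)
qed

lemma dist_stereo_inner: "(dist x y)\<^sup>2 = 2 - 2 * inner (stereo x) (stereo y)"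
proof -
  have "inner (stereo z) (stereo z) = 1" for z by (simp add: dot_square_norm)
  then show ?thesis
    by (simp add: dist_riemann_sphere_def dist_norm power2_norm_eq_inner inner_diff_left
        inner_diff_right inner_commute)
qed

section \<open>Compactness of the sphere\<close>

lemma range_stereo: "range stereo = sphere 0 1"
proof
  show "sphere 0 1 \<subseteq> range stereo"
  proof
    fix x :: "complex \<times> real" assume "x \<in> sphere 0 1"
    then obtain w t where x: "x = (w, t)" and wt: "(cmod w)\<^sup>2 + t\<^sup>2 = 1"
      by (cases x) (auto simp: norm_Pair)
    show "x \<in> range stereo"
    proof (cases "t = 1")
      case True
      then have "x = stereo Infty" using wt x by simp
      then show ?thesis by blast
    next
      case False
      have "t\<^sup>2 \<le> 1\<^sup>2" using wt by (smt (verit) zero_le_power2 power_one)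
      then have "t \<le> 1" by (rule power2_le_imp_le) simp
      then have t: "t < 1" using False by simp
      have n: "(cmod (w / of_real (1 - t)))\<^sup>2 = (1 + t) / (1 - t)"
      proof -
        have "(cmod w)\<^sup>2 = (1 + t) * (1 - t)"
          using wt by (simp add: algebra_simps power2_eq_square)
        then have "(cmod (w / of_real (1 - t)))\<^sup>2 = ((1 + t) * (1 - t)) / (1 - t)\<^sup>2"
          by (simp only: norm_divide power_divide norm_of_real power2_abs)
        then show ?thesis using t by (simp add: power2_eq_square)
      qed
      have e1: "1 + (1 + t) / (1 - t) = 2 / (1 - t)" "(1 + t) / (1 - t) + 1 = 2 / (1 - t)"
        "(1 + t) / (1 - t) - 1 = 2 * t / (1 - t)"
        using t by (simp_all add: field_simps)
      have c: "complex_of_real (1 - t) \<noteq> 0" using t by simp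
      have "stereo (Fin (w / of_real (1 - t))) = x"
        unfolding stereo.simps n e1 x using t c by (simp del: of_real_diff)
      then show ?thesis by (metis rangeI)
    qed
  qed
qed auto

section \<open>The isometries\<close>

lemma sphere_isometry_homog:
  assumes "u \<noteq> 0 \<or> v \<noteq> 0" and ab: "(cmod a)\<^sup>2 + (cmod b)\<^sup>2 = 1"
  shows "rat_eval [:- cnj b, a:] [:cnj a, b:] (homog u v)
    = homog (a * u - cnj b * v) (b * u + cnj a * v)"
proof -
  have ab0: "a \<noteq> 0 \<or> b \<noteq> 0" using ab by auto
  \<comment> \<open>At infinity \<open>rat_eval\<close> reads off the coefficients in this degree. It is 1 also when one of
    \<open>a, b\<close> vanishes, so that infinity is sent to \<open>a / b\<close>, the image of the vector \<open>(1, 0)\<close>.\<close>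
  have d: "max (degree [:- cnj b, a:]) (degree [:cnj a, b:]) = 1"
    using ab0 by auto
  show ?thesis
  proof (cases "v = 0")
    case True
    then show ?thesis using assms(1) unfolding rat_eval_def Let_def d
      by (simp add: homog_def)
  next
    case False
    have "cnj a + u / v * b = (b * u + cnj a * v) / v"
      "u / v * a - cnj b = (a * u - cnj b * v) / v"
      using False by (simp_all add: field_simps)
    then show ?thesis using False
      by (simp add: homog_def rat_eval_def)
  qed
qed

lemma unitary_norm:
  assumes "(cmod a)\<^sup>2 + (cmod b)\<^sup>2 = 1"
  shows "(cmod (a * u - cnj b * v))\<^sup>2 + (cmod (b * u + cnj a * v))\<^sup>2 = (cmod u)\<^sup>2 + (cmod v)\<^sup>2"
proof -
  have "(cmod (a * u - cnj b * v))\<^sup>2 + (cmod (b * u + cnj a * v))\<^sup>2 =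
      ((cmod a)\<^sup>2 + (cmod b)\<^sup>2) * ((cmod u)\<^sup>2 + (cmod v)\<^sup>2)"
    by (simp add: cmod_power2) algebra
  then show ?thesis by (simp add: assms)
qed

lemma dist_sphere_isometry:
  assumes "\<sigma> \<in> sphere_isometries"
  shows "dist (\<sigma> x) (\<sigma> y) = dist x y"
proof -
  obtain a b where \<sigma>: "\<sigma> = rat_eval [:- cnj b, a:] [:cnj a, b:]"
    and ab: "(cmod a)\<^sup>2 + (cmod b)\<^sup>2 = 1"
    using assms by (auto simp: sphere_isometries_def)
  obtain u v where x: "x = homog u v" "u \<noteq> 0 \<or> v \<noteq> 0" by (rule homog_cases)
  obtain u' v' where y: "y = homog u' v'" "u' \<noteq> 0 \<or> v' \<noteq> 0" by (rule homog_cases)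
  have nz: "a * p - cnj b * q \<noteq> 0 \<or> b * p + cnj a * q \<noteq> 0" if "p \<noteq> 0 \<or> q \<noteq> 0" for p q
    using unitary_norm[OF ab, of p q] cmod_square_sum_pos[OF that] by auto
  have "cnj a * a + cnj b * b = 1"
    using ab by (metis complex_norm_square mult.commute of_real_1 of_real_add)
  then have det: "(a * u - cnj b * v) * (b * u' + cnj a * v')
      - (a * u' - cnj b * v') * (b * u + cnj a * v) = u * v' - u' * v"
    by algebra
  have "inner (stereo (\<sigma> x)) (stereo (\<sigma> y)) = inner (stereo x) (stereo y)"
    using x y by (simp add: \<sigma> sphere_isometry_homog ab inner_stereo_homog[OF x(2) y(2)]
        inner_stereo_homog[OF nz[OF x(2)] nz[OF y(2)]] det unitary_norm)
  then have "(dist (\<sigma> x) (\<sigma> y))\<^sup>2 = (dist x y)\<^sup>2"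
    by (simp add: dist_stereo_inner)
  then show ?thesis by simp
qed

lemma sphere_isometry_inverse:
  assumes "\<sigma> \<in> sphere_isometries"
  obtains \<tau> where "\<tau> \<in> sphere_isometries" "\<And>x. \<tau> (\<sigma> x) = x" "\<And>x. \<sigma> (\<tau> x) = x"
proof -
  \<comment> \<open>The inverse of a special unitary matrix is its conjugate transpose, which replaces
    \<open>a, b\<close> by \<open>cnj a, - b\<close>.\<close>
  have inv: "rat_eval [:- cnj (- b), cnj a:] [:cnj (cnj a), - b:]
        (rat_eval [:- cnj b, a:] [:cnj a, b:] x) = x"
    if ab: "(cmod a)\<^sup>2 + (cmod b)\<^sup>2 = 1" for a b x
  proof -
    obtain u v where x: "x = homog u v" "u \<noteq> 0 \<or> v \<noteq> 0" by (rule homog_cases)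
    have nz: "a * u - cnj b * v \<noteq> 0 \<or> b * u + cnj a * v \<noteq> 0"
      using unitary_norm[OF ab, of u v] cmod_square_sum_pos[OF x(2)] by auto
    have ab': "(cmod (cnj a))\<^sup>2 + (cmod (- b))\<^sup>2 = 1" using ab by simp
    have "cnj a * a + cnj b * b = 1"
      using ab by (metis complex_norm_square mult.commute of_real_1 of_real_add)
    then have "cnj a * (a * u - cnj b * v) - cnj (- b) * (b * u + cnj a * v) = u"
      "- b * (a * u - cnj b * v) + cnj (cnj a) * (b * u + cnj a * v) = v"
      unfolding complex_cnj_cnj complex_cnj_minus by algebra+
    then show ?thesis
      by (simp only: x sphere_isometry_homog[OF x(2) ab] sphere_isometry_homog[OF nz ab'])
  qed
  obtain a b where \<sigma>: "\<sigma> = rat_eval [:- cnj b, a:] [:cnj a, b:]"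
    and ab: "(cmod a)\<^sup>2 + (cmod b)\<^sup>2 = 1"
    using assms by (auto simp: sphere_isometries_def)
  define \<tau> where "\<tau> = rat_eval [:- cnj (- b), cnj a:] [:cnj (cnj a), - b:]"
  have ab': "(cmod (cnj a))\<^sup>2 + (cmod (- b))\<^sup>2 = 1" using ab by simp
  show ?thesis
  proof (rule that[of \<tau>])
    show "\<tau> \<in> sphere_isometries"
      unfolding sphere_isometries_def \<tau>_def using ab' by blast
    show "\<tau> (\<sigma> x) = x" for x using inv[OF ab] by (simp add: \<tau>_def \<sigma>)
    show "\<sigma> (\<tau> x) = x" for x using inv[OF ab'] by (simp add: \<tau>_def \<sigma>)
  qed
qed

lemma dist_funpow_isometry:
  fixes f :: "'a::metric_space \<Rightarrow> 'a"
  assumes "\<And>x y. dist (f x) (f y) = dist x y"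
  shows "dist ((f ^^ n) x) ((f ^^ n) y) = dist x y"
  by (induction n) (simp_all add: assms)

section \<open>Normality along an isometry\<close>

text \<open>Arzela--Ascoli for isometries of the compact sphere. Transporting along \<open>stereo\<close> to the
  unit sphere of \<open>\<complex> \<times> \<real>\<close> makes the version for normed spaces applicable; since the
  unit sphere is closed, the limit map still takes values in it.\<close>

lemma isometries_uniform_subsequence:
  fixes f :: "nat \<Rightarrow> riemann_sphere \<Rightarrow> riemann_sphere"
  assumes iso: "\<And>n x y. dist (f n x) (f n y) = dist x y"
  obtains r g where "strict_mono r" "uniform_limit UNIV (\<lambda>n. f (r n)) g sequentially"
proof -
  let ?F = "\<lambda>n p. stereo (f n (inv stereo p))"
  have "compact (range stereo)" by (simp add: range_stereo)
  moreover have "norm (?F n p) \<le> 1" for n p by simp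
  moreover have "\<exists>d>0. \<forall>n q. q \<in> range stereo \<and> norm (p - q) < d \<longrightarrow> norm (?F n p - ?F n q) < e"
    if "p \<in> range stereo" "0 < e" for p e
  proof (intro exI[of _ e] conjI allI impI)
    fix n q assume q: "q \<in> range stereo \<and> norm (p - q) < e"
    have "dist (?F n p) (?F n q) = dist p q"
      using iso[of n "inv stereo p" "inv stereo q"] that q
      by (simp add: dist_riemann_sphere_def f_inv_into_f)
    then show "norm (?F n p - ?F n q) < e" using q by (simp add: dist_norm)
  qed (use that in simp)
  ultimately obtain g r where r: "strict_mono (r :: nat \<Rightarrow> nat)" and
    conv: "\<And>e. 0 < e \<Longrightarrow> \<exists>N. \<forall>n p. n \<ge> N \<and> p \<in> range stereo \<longrightarrow> norm (?F (r n) p - g p) < e"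
    by (rule Arzela_Ascoli[of "range stereo" ?F 1]) blast+
  have lim: "g p \<in> range stereo" if "p \<in> range stereo" for p
  proof -
    have "(\<lambda>n. ?F (r n) p) \<longlonglongrightarrow> g p"
      unfolding LIMSEQ_iff using conv that by blast
    then show ?thesis
      using closed_sequentially[of "range stereo" "\<lambda>n. ?F (r n) p"]
      by (auto simp: range_stereo)
  qed
  have "uniform_limit UNIV (\<lambda>n. f (r n)) (\<lambda>x. inv stereo (g (stereo x))) sequentially"
  proof (rule uniform_limitI)
    fix e :: real assume "e > 0"
    then obtain N where N: "\<And>n p. n \<ge> N \<Longrightarrow> p \<in> range stereo \<Longrightarrow> norm (?F (r n) p - g p) < e"
      using conv by blast
    have "dist (f (r n) x) (inv stereo (g (stereo x))) < e" if "n \<ge> N" for n x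
      using N[OF that, of "stereo x"] lim[of "stereo x"]
      by (simp add: dist_riemann_sphere_def dist_norm f_inv_into_f inj_stereo)
    then show "\<forall>\<^sub>F n in sequentially. \<forall>x\<in>UNIV.
        dist (f (r n) x) (inv stereo (g (stereo x))) < e"
      by (auto simp: eventually_sequentially)
  qed
  then show ?thesis using r that by blast
qed

lemma uniform_limit_compose_isometries:
  fixes f :: "nat \<Rightarrow> 'b::metric_space \<Rightarrow> 'b"
  assumes iso: "\<And>n x y. dist (f n x) (f n y) = dist x y"
    and f: "uniform_limit UNIV f f' sequentially"
    and h: "uniform_limit K h h' sequentially"
  shows "uniform_limit K (\<lambda>n x. f n (h n x)) (\<lambda>x. f' (h' x)) sequentially"
proof (rule uniform_limitI)
  fix e :: real assume "e > 0"
  then have e: "e / 2 > 0" by simp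
  show "\<forall>\<^sub>F n in sequentially. \<forall>x\<in>K. dist (f n (h n x)) (f' (h' x)) < e"
    using uniform_limitD[OF f e] uniform_limitD[OF h e]
  proof eventually_elim
    case (elim n)
    show ?case
    proof
      fix x assume "x \<in> K"
      then have "dist (f n (h n x)) (f n (h' x)) < e / 2" "dist (f n (h' x)) (f' (h' x)) < e / 2"
        using elim by (auto simp: iso)
      then show "dist (f n (h n x)) (f' (h' x)) < e"
        by (smt (verit) dist_triangle field_sum_of_halves)
    qed
  qed
qed

text \<open>Each iterate acquires its own isometry \<open>\<tau> n\<close>, and these need not converge; compactness of
  the isometry group is what allows passing to a common subsequence.\<close>

lemma normal_family_on_isometry:
  fixes R \<sigma> \<sigma>' :: "riemann_sphere \<Rightarrow> riemann_sphere"
  assumes normal: "normal_family_on U (range (\<lambda>n. R ^^ n))"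
    and \<sigma>': "continuous_on UNIV \<sigma>'" "\<And>x. \<sigma> (\<sigma>' x) = x"
    and \<tau>: "\<And>n x y. dist (\<tau> n x) (\<tau> n y) = dist x y"
    and R: "\<And>n x. (R ^^ n) (\<sigma> x) = \<tau> n ((R ^^ n) x)"
  shows "normal_family_on (\<sigma>' -` U) (range (\<lambda>n. R ^^ n))"
  unfolding normal_family_on_def
proof (intro allI impI)
  fix f :: "nat \<Rightarrow> riemann_sphere \<Rightarrow> riemann_sphere"
  assume f: "range f \<subseteq> range (\<lambda>n. R ^^ n)"
  then have "\<forall>j. \<exists>n. f j = R ^^ n" by blast
  then obtain m where m: "\<And>j. f j = R ^^ m j" by metis
  from normal[unfolded normal_family_on_def, rule_format, OF f]
  obtain r g where r: "strict_mono r"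
    and g: "\<And>K. compact K \<Longrightarrow> K \<subseteq> U \<Longrightarrow> uniform_limit K (\<lambda>n. f (r n)) g sequentially"
    by blast
  obtain s t where s: "strict_mono s"
    and t: "uniform_limit UNIV (\<lambda>n. \<tau> (m (r (s n)))) t sequentially"
    by (rule isometries_uniform_subsequence[of "\<lambda>n. \<tau> (m (r n))", OF \<tau>])
  show "\<exists>r g. strict_mono r \<and> (\<forall>K. compact K \<and> K \<subseteq> \<sigma>' -` U \<longrightarrow>
      uniform_limit K (\<lambda>n. f (r n)) g sequentially)"
  proof (intro exI[of _ "r \<circ> s"] exI[of _ "\<lambda>y. t (g (\<sigma>' y))"] conjI allI impI)
    show "strict_mono (r \<circ> s)" using r s by (rule strict_mono_o)
    fix K assume K: "compact K \<and> K \<subseteq> \<sigma>' -` U"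
    have "compact (\<sigma>' ` K)"
      using continuous_on_subset[OF \<sigma>'(1) subset_UNIV] K by (blast intro: compact_continuous_image)
    moreover have "\<sigma>' ` K \<subseteq> U" using K by blast
    ultimately have "uniform_limit (\<sigma>' ` K) (\<lambda>n. f (r n)) g sequentially" by (rule g)
    from filterlim_compose[OF this filterlim_subseq[OF s]]
    have "uniform_limit (\<sigma>' ` K) (\<lambda>n. f (r (s n))) g sequentially" .
    then have "uniform_limit (\<sigma>' ` K) (\<lambda>n x. \<tau> (m (r (s n))) (f (r (s n)) x)) (\<lambda>x. t (g x))
        sequentially"
      by (rule uniform_limit_compose_isometries[OF \<tau> t])
    then have "uniform_limit K (\<lambda>n y. \<tau> (m (r (s n))) (f (r (s n)) (\<sigma>' y)))
        (\<lambda>y. t (g (\<sigma>' y))) sequentially"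
      by (rule uniform_limit_compose') auto
    moreover have "\<tau> (m j) (f j (\<sigma>' y)) = f j y" for j y
      using R[of "m j" "\<sigma>' y"] by (simp add: m \<sigma>'(2))
    ultimately show "uniform_limit K (\<lambda>n. f ((r \<circ> s) n)) (\<lambda>y. t (g (\<sigma>' y))) sequentially"
      by simp
  qed
qed

section \<open>Invariance of the Fatou and Julia sets\<close>

lemma funpow_semiconj:
  assumes "\<And>x. R (\<sigma> x) = (\<sigma> ^^ k) (R x)"
  shows "(R ^^ n) (\<sigma> x) = (\<sigma> ^^ (k ^ n)) ((R ^^ n) x)"
proof (induction n)
  case (Suc n)
  have "R ((\<sigma> ^^ j) y) = (\<sigma> ^^ (k * j)) (R y)" for j y
    by (induction j) (simp_all add: assms funpow_add)
  then show ?case by (simp add: Suc)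
qed simp

text \<open>The open set witnessing \<open>x \<in> Fatou_set R\<close> is carried along by \<open>\<sigma>\<close>. Its image is
  written as a preimage under the inverse, since continuity of the inverse makes it open.\<close>

lemma Fatou_set_semiconj_isometry:
  assumes \<sigma>: "\<sigma> \<in> sphere_isometries"
    and R: "\<And>x. R (\<sigma> x) = (\<sigma> ^^ k) (R x)"
  shows "\<sigma> ` Fatou_set R \<subseteq> Fatou_set R"
proof
  obtain \<sigma>' where \<sigma>': "\<sigma>' \<in> sphere_isometries" "\<And>x. \<sigma>' (\<sigma> x) = x" "\<And>x. \<sigma> (\<sigma>' x) = x"
    using sphere_isometry_inverse[OF \<sigma>] by blast
  have cont: "continuous_on UNIV \<sigma>'"
    unfolding continuous_on_iff using dist_sphere_isometry[OF \<sigma>'(1)] by metis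
  fix y assume "y \<in> \<sigma> ` Fatou_set R"
  then obtain x U where y: "y = \<sigma> x" and U: "open U" "x \<in> U"
    and normal: "normal_family_on U (range (\<lambda>n. R ^^ n))"
    by (auto simp: Fatou_set_def)
  have "normal_family_on (\<sigma>' -` U) (range (\<lambda>n. R ^^ n))"
    using normal cont \<sigma>'(3) dist_funpow_isometry[OF dist_sphere_isometry[OF \<sigma>]]
      funpow_semiconj[of R \<sigma> k, OF R]
    by (rule normal_family_on_isometry)
  moreover have "open (\<sigma>' -` U)" using U(1) cont by (rule open_vimage)
  moreover have "y \<in> \<sigma>' -` U" using U(2) by (simp add: y \<sigma>'(2))
  ultimately show "y \<in> Fatou_set R" unfolding Fatou_set_def by blast
qed

theorem proposition1:
  fixes R \<sigma> :: "riemann_sphere \<Rightarrow> riemann_sphere" and k :: nat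
  assumes "rational_map R"
    and "\<not> Lattes_map R"
    and "\<sigma> \<in> sphere_isometries"
    and "k \<ge> 1"
    and "R \<circ> \<sigma> = (\<sigma> ^^ k) \<circ> R"
  shows "\<sigma> \<in> Julia_symmetries R"
proof -
  obtain \<tau> where \<tau>: "\<tau> \<in> sphere_isometries" "\<And>x. \<tau> (\<sigma> x) = x" "\<And>x. \<sigma> (\<tau> x) = x"
    using sphere_isometry_inverse[OF assms(3)] by blast
  have R: "R (\<sigma> x) = (\<sigma> ^^ k) (R x)" for x
    using fun_cong[OF assms(5), of x] by simp
  have inv: "(\<tau> ^^ n) ((\<sigma> ^^ n) x) = x" for n x
  proof (induction n)
    case (Suc n)
    then show ?case
      by (simp only: funpow_Suc_right[of n \<tau>] funpow.simps(2)[of n \<sigma>] comp_apply \<tau>(2))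
  qed simp
  have R': "R (\<tau> x) = (\<tau> ^^ k) (R x)" for x
    using R[of "\<tau> x"] inv[of k "R (\<tau> x)"] by (simp add: \<tau>)
  have "\<sigma> ` Fatou_set R \<subseteq> Fatou_set R" "\<tau> ` Fatou_set R \<subseteq> Fatou_set R"
    using Fatou_set_semiconj_isometry[of \<sigma> R k, OF assms(3) R]
      Fatou_set_semiconj_isometry[of \<tau> R k, OF \<tau>(1) R'] by blast+
  then have "\<sigma> x \<in> Julia_set R \<longleftrightarrow> x \<in> Julia_set R" for x
    unfolding Julia_set_def Compl_iff
    using \<tau>(2) by (metis image_subset_iff)
  then have "\<sigma> ` Julia_set R = Julia_set R"
    using \<tau>(3) by (metis image_eqI image_subset_iff subsetI subset_antisym)
  then show ?thesis using assms(3) by (simp add: Julia_symmetries_def)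
qed

end
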